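(* A displacement field $\mathbf{u}:\Omega\to\mathbb{R}^3$ is universal for the tetragonal class $\mathbb{Z}_4$ of linear strain-gradient elastic solids if and only if it is the superposition (sum) of a homogeneous displacement field and a field of the form $$\bigl(c_1x_2x_3+c_2x_1x_3,\; -c_2x_2x_3+c_3x_1x_3,\; g(x_1,x_2)\bigr),\qquad g(x_1,x_2)=d_1+d_2x_1+d_3x_2+d_4x_1x_2+d_5(x_2^2-x_1^2),$$ for some real constants $c_1,c_2,c_3,d_1,\dots,d_5$.
   Context: $\Omega\subset\mathbb{R}^3$ is a nonempty convex open set with Cartesian coordinates $(x_1,x_2,x_3)$ and orthonormal basis $e_1,e_2,e_3$. Repeated indices are summed over $1,2,3$ and a comma denotes partial differentiation. A displacement field is a smooth map $\mathbf{u}:\Omega\to\mathbb{R}^3$, with strain $e_{lm}=\tfrac12(u_{l,m}+u_{m,l})$. It is homogeneous if $\mathbf{u}(\mathbf{x})=\mathbf{H}\mathbf{x}+\mathbf{b}$ for a constant matrix $\mathbf{H}$ and constant vector $\mathbf{b}$. A strain-gradient material is a triple $(\mathsf{C},\mathsf{M},\mathsf{A})$ of constant real tensors of orders $4,5,6$ with index symmetries $\mathsf{C}_{ijlm}=\mathsf{C}_{jilm}=\mathsf{C}_{lmij}$, $\mathsf{M}_{ijklm}=\mathsf{M}_{jiklm}=\mathsf{M}_{ijlkm}$, $\mathsf{A}_{ijklmn}=\mathsf{A}_{jiklmn}=\mathsf{A}_{lmnijk}$. Its stress and hyper-stress are $\sigma_{ij}=\mathsf{C}_{ijlm}e_{lm}+\mathsf{M}_{ijlmn}e_{lm,n}$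 and $\tau_{ijk}=\mathsf{M}_{lmijk}e_{lm}+\mathsf{A}_{ijklmn}e_{lm,n}$, and the equilibrium equations without body forces are $\sigma_{ij,j}-\tau_{ijk,jk}=0$ in $\Omega$ for $i=1,2,3$. For a subgroup $G\subset \mathrm{O}(3)$, a tensor $T$ of order $p$ is $G$-invariant if $Q_{i_1j_1}\cdots Q_{i_pj_p}T_{j_1\dots j_p}=T_{i_1\dots i_p}$ for all $Q\in G$. $\mathbb{Z}_4$ is generated by the rotation by $\pi/2$ about $e_3$; $\mathbb{D}_4$ is generated by $\mathbb{Z}_4$ and the rotation by $\pi$ about $e_1$; $\mathbb{Z}_2^c=\{I,-I\}$, and $G\oplus\mathbb{Z}_2^c$ is the group generated by $G$ and $-I$. The tetragonal class $\mathbb{Z}_4$ is the set of all materials with $\mathsf{C}$ $\mathbb{D}_4\oplus\mathbb{Z}_2^c$-invariant (6 independent constants), $\mathsf{M}$ $\mathbb{Z}_4$-invariant, and $\mathsf{A}$ $\mathbb{Z}_4\oplus\mathbb{Z}_2^c$-invariant (45 independent constants). A displacement field is universal for the class if it satisfies the equilibrium equations for every material in the class. *)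

theory Defs
  imports "HOL-Analysis.Analysis" "HOL-Algebra.Generated_Groups"
begin

section \<open>Partial derivatives and smooth displacement fields\<close>

definition partial :: "3 \<Rightarrow> (real^3 \<Rightarrow> real) \<Rightarrow> real^3 \<Rightarrow> real" where
  "partial i f x = deriv (\<lambda>t. f (x + t *\<^sub>R axis i 1)) 0"

text \<open>
  Fields on \<open>\<Omega>\<close> are total functions on the whole space whose values outside \<open>\<Omega>\<close> are
  irrelevant.  The notions below are meant for open \<open>\<Omega>\<close>, where \<open>partial i f\<close>
  on \<open>\<Omega>\<close> depends only on the values of \<open>f\<close> on \<open>\<Omega>\<close>.
\<close>

primrec Ck_on :: "nat \<Rightarrow> (real^3) set \<Rightarrow> (real^3 \<Rightarrow> real) \<Rightarrow> bool" where
  "Ck_on 0 \<Omega> f \<longleftrightarrow> continuous_on \<Omega> f"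
| "Ck_on (Suc k) \<Omega> f \<longleftrightarrow> f differentiable_on \<Omega> \<and> (\<forall>i. Ck_on k \<Omega> (partial i f))"

definition smooth_field :: "(real^3) set \<Rightarrow> (real^3 \<Rightarrow> real) \<Rightarrow> bool" where
  "smooth_field \<Omega> f \<longleftrightarrow> (\<forall>k. Ck_on k \<Omega> f)"

definition displacement_field :: "(real^3) set \<Rightarrow> (real^3 \<Rightarrow> real^3) \<Rightarrow> bool" where
  "displacement_field \<Omega> u \<longleftrightarrow> (\<forall>i. smooth_field \<Omega> (\<lambda>x. u x $ i))"

definition homogeneous :: "(real^3) set \<Rightarrow> (real^3 \<Rightarrow> real^3) \<Rightarrow> bool" where
  "homogeneous \<Omega> u \<longleftrightarrow> (\<exists>(H :: real^3^3) (b :: real^3). \<forall>x\<in>\<Omega>. u x = H *v x + b)"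

definition strain :: "(real^3 \<Rightarrow> real^3) \<Rightarrow> 3 \<Rightarrow> 3 \<Rightarrow> real^3 \<Rightarrow> real" where
  "strain u l m = (\<lambda>x. 1/2 * (partial m (\<lambda>y. u y $ l) x + partial l (\<lambda>y. u y $ m) x))"


section \<open>Strain-gradient materials and equilibrium\<close>

type_synonym tensor4 = "3 \<Rightarrow> 3 \<Rightarrow> 3 \<Rightarrow> 3 \<Rightarrow> real"
type_synonym tensor5 = "3 \<Rightarrow> 3 \<Rightarrow> 3 \<Rightarrow> 3 \<Rightarrow> 3 \<Rightarrow> real"
type_synonym tensor6 = "3 \<Rightarrow> 3 \<Rightarrow> 3 \<Rightarrow> 3 \<Rightarrow> 3 \<Rightarrow> 3 \<Rightarrow> real"

definition strain_gradient_material :: "tensor4 \<times> tensor5 \<times> tensor6 \<Rightarrow> bool" where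
  "strain_gradient_material = (\<lambda>(C, M, A).
     (\<forall>i j l m. C i j l m = C j i l m \<and> C i j l m = C l m i j) \<and>
     (\<forall>i j k l m. M i j k l m = M j i k l m \<and> M i j k l m = M i j l k m) \<and>
     (\<forall>i j k l m n. A i j k l m n = A j i k l m n \<and> A i j k l m n = A l m n i j k))"

definition stress :: "tensor4 \<Rightarrow> tensor5 \<Rightarrow> (real^3 \<Rightarrow> real^3) \<Rightarrow> 3 \<Rightarrow> 3 \<Rightarrow> real^3 \<Rightarrow> real" where
  "stress C M u i j = (\<lambda>x.
     (\<Sum>l\<in>UNIV. \<Sum>m\<in>UNIV. C i j l m * strain u l m x) +
     (\<Sum>l\<in>UNIV. \<Sum>m\<in>UNIV. \<Sum>n\<in>UNIV. M i j l m n * partial n (strain u l m) x))"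

definition hyperstress :: "tensor5 \<Rightarrow> tensor6 \<Rightarrow> (real^3 \<Rightarrow> real^3) \<Rightarrow> 3 \<Rightarrow> 3 \<Rightarrow> 3 \<Rightarrow> real^3 \<Rightarrow> real" where
  "hyperstress M A u i j k = (\<lambda>x.
     (\<Sum>l\<in>UNIV. \<Sum>m\<in>UNIV. M l m i j k * strain u l m x) +
     (\<Sum>l\<in>UNIV. \<Sum>m\<in>UNIV. \<Sum>n\<in>UNIV. A i j k l m n * partial n (strain u l m) x))"

definition equilibrium :: "(real^3) set \<Rightarrow> tensor4 \<times> tensor5 \<times> tensor6 \<Rightarrow> (real^3 \<Rightarrow> real^3) \<Rightarrow> bool" where
  "equilibrium \<Omega> = (\<lambda>(C, M, A) u. \<forall>x\<in>\<Omega>. \<forall>i.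
     (\<Sum>j\<in>UNIV. partial j (stress C M u i j) x) -
     (\<Sum>j\<in>UNIV. \<Sum>k\<in>UNIV. partial k (partial j (hyperstress M A u i j k)) x) = 0)"


section \<open>Symmetry groups and invariant tensors\<close>

definition O3 :: "(real^3^3) monoid" where
  "O3 = \<lparr>carrier = {Q. orthogonal_matrix Q}, mult = (**), one = mat 1\<rparr>"

definition rot_e1 :: "real \<Rightarrow> real^3^3" where
  "rot_e1 \<theta> = vector [vector [1, 0, 0],
                       vector [0, cos \<theta>, - sin \<theta>],
                       vector [0, sin \<theta>, cos \<theta>]]"

definition rot_e3 :: "real \<Rightarrow> real^3^3" where
  "rot_e3 \<theta> = vector [vector [cos \<theta>, - sin \<theta>, 0],
                       vector [sin \<theta>, cos \<theta>, 0],
                       vector [0, 0, 1]]"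

definition Z4 :: "(real^3^3) set" where
  "Z4 = generate O3 {rot_e3 (pi/2)}"

definition D4 :: "(real^3^3) set" where
  "D4 = generate O3 (Z4 \<union> {rot_e1 pi})"

definition Z2c :: "(real^3^3) set" where
  "Z2c = {mat 1, - mat 1}"

definition plus_Z2c :: "(real^3^3) set \<Rightarrow> (real^3^3) set" where
  "plus_Z2c G = generate O3 (G \<union> Z2c)"

text \<open>
  The inverses occurring in \<^const>\<open>generate\<close> are those of the group \<open>O3\<close>; the following facts
  ensure that they are genuine matrix inverses and that all sets above are subgroups of \<open>O3\<close>.
\<close>

lemma group_O3: "group O3"
proof (rule groupI)
  fix Q assume "Q \<in> carrier O3"
  then show "\<exists>P\<in>carrier O3. P \<otimes>\<^bsub>O3\<^esub> Q = \<one>\<^bsub>O3\<^esub>"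
    by (intro bexI[of _ "transpose Q"]) (simp_all add: O3_def orthogonal_matrix_def)
qed (auto simp: O3_def orthogonal_matrix_mul orthogonal_matrix_id matrix_mul_assoc)

lemma rotations_in_O3: "rot_e1 \<theta> \<in> carrier O3" "rot_e3 \<theta> \<in> carrier O3"
  by (simp_all add: O3_def orthogonal_matrix rot_e1_def rot_e3_def vec_eq_iff forall_3
      matrix_matrix_mult_def transpose_def mat_def sum_3 vector_3 sin_cos_squared_add3 add.commute
      flip: power2_eq_square)

lemma Z2c_in_O3: "Z2c \<subseteq> carrier O3"
  by (simp add: Z2c_def O3_def orthogonal_matrix vec_eq_iff forall_3
      matrix_matrix_mult_def transpose_def mat_def sum_3)

lemma subgroup_Z4: "subgroup Z4 O3"
  unfolding Z4_def
  by (rule group.generate_is_subgroup[OF group_O3]) (simp add: rotations_in_O3)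

lemma subgroup_D4: "subgroup D4 O3"
  unfolding D4_def
  by (rule group.generate_is_subgroup[OF group_O3])
    (simp add: rotations_in_O3 subgroup.subset[OF subgroup_Z4])

lemma subgroup_plus_Z2c: "subgroup G O3 \<Longrightarrow> subgroup (plus_Z2c G) O3"
  unfolding plus_Z2c_def
  by (rule group.generate_is_subgroup[OF group_O3])
    (simp add: Z2c_in_O3 subgroup.subset)

definition invariant4 :: "(real^3^3) set \<Rightarrow> tensor4 \<Rightarrow> bool" where
  "invariant4 G T \<longleftrightarrow> (\<forall>Q\<in>G. \<forall>i1 i2 i3 i4.
     (\<Sum>j1\<in>UNIV. \<Sum>j2\<in>UNIV. \<Sum>j3\<in>UNIV. \<Sum>j4\<in>UNIV.
        Q $ i1 $ j1 * Q $ i2 $ j2 * Q $ i3 $ j3 * Q $ i4 $ j4 * T j1 j2 j3 j4)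
     = T i1 i2 i3 i4)"

definition invariant5 :: "(real^3^3) set \<Rightarrow> tensor5 \<Rightarrow> bool" where
  "invariant5 G T \<longleftrightarrow> (\<forall>Q\<in>G. \<forall>i1 i2 i3 i4 i5.
     (\<Sum>j1\<in>UNIV. \<Sum>j2\<in>UNIV. \<Sum>j3\<in>UNIV. \<Sum>j4\<in>UNIV. \<Sum>j5\<in>UNIV.
        Q $ i1 $ j1 * Q $ i2 $ j2 * Q $ i3 $ j3 * Q $ i4 $ j4 * Q $ i5 $ j5 * T j1 j2 j3 j4 j5)
     = T i1 i2 i3 i4 i5)"

definition invariant6 :: "(real^3^3) set \<Rightarrow> tensor6 \<Rightarrow> bool" where
  "invariant6 G T \<longleftrightarrow> (\<forall>Q\<in>G. \<forall>i1 i2 i3 i4 i5 i6.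
     (\<Sum>j1\<in>UNIV. \<Sum>j2\<in>UNIV. \<Sum>j3\<in>UNIV. \<Sum>j4\<in>UNIV. \<Sum>j5\<in>UNIV. \<Sum>j6\<in>UNIV.
        Q $ i1 $ j1 * Q $ i2 $ j2 * Q $ i3 $ j3 * Q $ i4 $ j4 * Q $ i5 $ j5 * Q $ i6 $ j6
          * T j1 j2 j3 j4 j5 j6)
     = T i1 i2 i3 i4 i5 i6)"

definition tetragonal_class_Z4 :: "(tensor4 \<times> tensor5 \<times> tensor6) set" where
  "tetragonal_class_Z4 = {(C, M, A). strain_gradient_material (C, M, A) \<and>
     invariant4 (plus_Z2c D4) C \<and> invariant5 Z4 M \<and> invariant6 (plus_Z2c Z4) A}"

definition universal :: "(real^3) set \<Rightarrow> (tensor4 \<times> tensor5 \<times> tensor6) set \<Rightarrow> (real^3 \<Rightarrow> real^3) \<Rightarrow> bool" where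
  "universal \<Omega> \<K> u \<longleftrightarrow> (\<forall>\<mu>\<in>\<K>. equilibrium \<Omega> \<mu> u)"

end

theory Submission
  imports Defs
begin

text \<open>
  The materials with \<open>M = A = 0\<close> already force, one elastic constant at a time, thirteen linear
  relations between the second partials of \<open>u\<close>.  They leave only \<open>u\<^sub>1\<close> and \<open>u\<^sub>2\<close> quadratic with
  \<open>x\<^sub>2x\<^sub>3\<close> and \<open>x\<^sub>1x\<^sub>3\<close> terms, and \<open>u\<^sub>3\<close> a harmonic function of \<open>x\<^sub>1, x\<^sub>2\<close> up to an affine term.
  A single tensor \<open>M\<close>, available because \<open>\<int>\<^sub>4\<close> has an invariant of this type with an odd number of
  indices 3, additionally kills \<open>u\<^sub>3\<^sub>,\<^sub>1\<^sub>1\<^sub>1\<close> and \<open>u\<^sub>3\<^sub>,\<^sub>2\<^sub>2\<^sub>2\<close>, hence by harmonicity all third partials of \<open>u\<^sub>3\<close>.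
  So every component is a quadratic polynomial.  Conversely, for quadratic fields the terms with
  \<open>M\<close> and \<open>A\<close> vanish, and every invariant \<open>C\<close> has the six-constant form for which
  the thirteen relations imply equilibrium.
\<close>

section \<open>Partial derivatives\<close>

text \<open>The chain rule along the coordinate line through \<open>x\<close> turns the one-variable
  \<open>deriv\<close> into a value of the total derivative, so the calculus of
  \<open>has_derivative\<close> becomes available for \<open>partial\<close>.\<close>

lemma partial_eqI:
  assumes "(f has_derivative f') (at x)"
  shows "partial i f x = f' (axis i 1)"
proof -
  have "((\<lambda>t. x + t *\<^sub>R axis i 1) has_derivative (\<lambda>t. t *\<^sub>R axis i 1)) (at 0)"
    by (auto intro!: derivative_eq_intros)
  then have "((\<lambda>t. f (x + t *\<^sub>R axis i 1)) has_derivative (\<lambda>t. f' (t *\<^sub>R axis i 1))) (at 0)"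
    by (rule has_derivative_compose) (use assms in simp)
  moreover have "(\<lambda>t. f' (t *\<^sub>R axis i 1)) = (*) (f' (axis i 1))"
    using linear_scale[OF has_derivative_linear[OF assms]] by (simp add: fun_eq_iff)
  ultimately show ?thesis
    by (simp add: partial_def DERIV_imp_deriv has_field_derivative_def)
qed

lemma sum_axis: "(\<Sum>j\<in>UNIV. axis i (1::real) $ j * p j) = p i"
  by (simp add: axis_def if_distrib[of "\<lambda>a. a * _"] cong: if_cong)

lemma has_derivative_partials:
  assumes "f differentiable at x"
  shows "(f has_derivative (\<lambda>h. \<Sum>i\<in>UNIV. h $ i * partial i f x)) (at x)"
proof -
  obtain f' where f': "(f has_derivative f') (at x)"
    using assms by (auto simp: differentiable_def)
  have "f' h = (\<Sum>i\<in>UNIV. h $ i * partial i f x)" for h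
  proof -
    have "f' h = f' (\<Sum>i\<in>UNIV. h $ i *s axis i 1)"
      by (simp add: basis_expansion)
    also have "\<dots> = (\<Sum>i\<in>UNIV. h $ i * partial i f x)"
      using has_derivative_linear[OF f'] partial_eqI[OF f']
      by (simp add: linear_sum linear_scale scalar_mult_eq_scaleR)
    finally show ?thesis .
  qed
  then have "f' = (\<lambda>h. \<Sum>i\<in>UNIV. h $ i * partial i f x)" by blast
  with f' show ?thesis by simp
qed

lemma partial_has_real_derivative:
  assumes "f differentiable at (x + t *\<^sub>R axis i 1)"
  shows "((\<lambda>t. f (x + t *\<^sub>R axis i 1)) has_real_derivative partial i f (x + t *\<^sub>R axis i 1)) (at t)"
proof -
  have "((\<lambda>t. x + t *\<^sub>R axis i 1) has_derivative (\<lambda>t. t *\<^sub>R axis i 1)) (at t)"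
    by (auto intro!: derivative_eq_intros)
  from has_derivative_compose[OF this has_derivative_partials[OF assms]]
  show ?thesis
    by (simp add: has_field_derivative_def sum_axis mult.assoc mult_commute_abs flip: sum_distrib_left)
qed

lemma partial_mvt:
  assumes "0 < h" and diff: "\<And>t. 0 \<le> t \<Longrightarrow> t \<le> h \<Longrightarrow> f differentiable at (x + t *\<^sub>R axis i 1)"
  obtains t where "0 < t" "t < h"
    "f (x + h *\<^sub>R axis i 1) - f x = h * partial i f (x + t *\<^sub>R axis i 1)"
proof -
  have "\<exists>t>0. t < h \<and> f (x + h *\<^sub>R axis i 1) - f (x + 0 *\<^sub>R axis i 1)
      = (h - 0) * partial i f (x + t *\<^sub>R axis i 1)"
    using \<open>0 < h\<close> by (rule MVT2) (auto intro: partial_has_real_derivative diff)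
  with that show thesis by auto
qed

section \<open>Linearity of partial derivatives\<close>

lemma partial_add:
  assumes "f differentiable at x" "g differentiable at x"
  shows "partial i (\<lambda>x. f x + g x) x = partial i f x + partial i g x"
  using partial_eqI[OF has_derivative_add[OF assms[THEN has_derivative_partials]], of i]
    partial_eqI[OF has_derivative_partials[OF assms(1)], of i]
    partial_eqI[OF has_derivative_partials[OF assms(2)], of i]
  by simp

lemma partial_cmult:
  assumes "f differentiable at x"
  shows "partial i (\<lambda>x. c * f x) x = c * partial i f x"
  using partial_eqI[OF has_derivative_mult_right[OF has_derivative_partials[OF assms], of c], of i]
    partial_eqI[OF has_derivative_partials[OF assms], of i]
  by simp

lemma partial_const [simp]: "partial i (\<lambda>x. c) x = 0"
  by (simp add: partial_def)

lemma partial_diff: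
  assumes "f differentiable at x" "g differentiable at x"
  shows "partial i (\<lambda>x. f x - g x) x = partial i f x - partial i g x"
  using partial_eqI[OF has_derivative_diff[OF assms[THEN has_derivative_partials]], of i]
    partial_eqI[OF has_derivative_partials[OF assms(1)], of i]
    partial_eqI[OF has_derivative_partials[OF assms(2)], of i]
  by simp

section \<open>Second differences and the symmetry of second partials\<close>

lemma partial_translate: "partial i (\<lambda>x. f (x + a)) x = partial i f (x + a)"
  by (simp add: partial_def algebra_simps)

text \<open>The mean value theorem is applied twice: in direction \<open>i\<close> to an increment
  of \<open>f\<close> in direction \<open>j\<close>, then in direction \<open>j\<close> to
  \<open>partial i f\<close>.\<close>

lemma second_difference:
  assumes "0 < h"
    and S: "\<And>s t. 0 \<le> s \<Longrightarrow> s \<le> h \<Longrightarrow> 0 \<le> t \<Longrightarrow> t \<le> h \<Longrightarrow>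
        x + s *\<^sub>R axis i 1 + t *\<^sub>R axis j 1 \<in> S"
    and f: "\<And>y. y \<in> S \<Longrightarrow> f differentiable at y"
    and fi: "\<And>y. y \<in> S \<Longrightarrow> partial i f differentiable at y"
  obtains s t where "0 < s" "s < h" "0 < t" "t < h"
    "f (x + h *\<^sub>R axis i 1 + h *\<^sub>R axis j 1) - f (x + h *\<^sub>R axis i 1) - f (x + h *\<^sub>R axis j 1) + f x
      = h\<^sup>2 * partial j (partial i f) (x + s *\<^sub>R axis i 1 + t *\<^sub>R axis j 1)"
proof -
  define g where "g = (\<lambda>y. f (y + h *\<^sub>R axis j 1) - f y)"
  have fs: "f differentiable at (x + s *\<^sub>R axis i 1)" if "0 \<le> s" "s \<le> h" for s
    using f[OF S, of s 0] that \<open>0 < h\<close> by simp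
  have fsh: "(\<lambda>y. f (y + h *\<^sub>R axis j 1)) differentiable at (x + s *\<^sub>R axis i 1)"
    if "0 \<le> s" "s \<le> h" for s
    using f[OF S, of s h] that \<open>0 < h\<close>
    by (intro differentiable_compose[of f "\<lambda>y. y + h *\<^sub>R axis j 1"]) simp_all
  have g: "g differentiable at (x + s *\<^sub>R axis i 1)" if "0 \<le> s" "s \<le> h" for s
    unfolding g_def by (intro differentiable_diff fs fsh that)
  obtain s where s: "0 < s" "s < h"
    and gs: "g (x + h *\<^sub>R axis i 1) - g x = h * partial i g (x + s *\<^sub>R axis i 1)"
    using partial_mvt[OF \<open>0 < h\<close> g] by blast
  have pg: "partial i g (x + s *\<^sub>R axis i 1) =
      partial i f (x + s *\<^sub>R axis i 1 + h *\<^sub>R axis j 1) - partial i f (x + s *\<^sub>R axis i 1)"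
    unfolding g_def using s by (simp add: partial_diff fs fsh partial_translate)
  obtain t where t: "0 < t" "t < h" and ft: "partial i f (x + s *\<^sub>R axis i 1 + h *\<^sub>R axis j 1) -
      partial i f (x + s *\<^sub>R axis i 1) =
      h * partial j (partial i f) (x + s *\<^sub>R axis i 1 + t *\<^sub>R axis j 1)"
    by (rule partial_mvt[OF \<open>0 < h\<close>, of "partial i f" "x + s *\<^sub>R axis i 1" j])
       (use s in \<open>auto intro!: fi S\<close>)
  show thesis
    by (rule that[OF s t]) (use gs pg ft in \<open>simp add: g_def power2_eq_square algebra_simps\<close>)
qed

text \<open>
  Both mixed partials are mean values of the same second difference, so they cannot be separated
  by a constant near a point where they are continuous.
\<close>

lemma mixed_partials_not_less:
  assumes "open \<Omega>" "x \<in> \<Omega>"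
    and f: "\<And>y. y \<in> \<Omega> \<Longrightarrow> f differentiable at y"
    and fi: "\<And>y. y \<in> \<Omega> \<Longrightarrow> partial i f differentiable at y"
    and fj: "\<And>y. y \<in> \<Omega> \<Longrightarrow> partial j f differentiable at y"
    and "isCont (partial j (partial i f)) x" "isCont (partial i (partial j f)) x"
  shows "\<not> partial j (partial i f) x < partial i (partial j f) x"
proof
  assume "partial j (partial i f) x < partial i (partial j f) x"
  then obtain c where c: "partial j (partial i f) x < c" "c < partial i (partial j f) x"
    using dense by blast
  have "\<forall>\<^sub>F y in nhds x. y \<in> \<Omega> \<and> partial j (partial i f) y < c \<and> c < partial i (partial j f) y"
    using assms c
    by (intro eventually_conj order_tendstoD eventually_nhds_in_open)
       (auto simp: isCont_def tendsto_at_iff_tendsto_nhds)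
  then obtain r where "r > 0"
    and r: "\<And>y. dist y x < r \<Longrightarrow>
      y \<in> \<Omega> \<and> partial j (partial i f) y < c \<and> c < partial i (partial j f) y"
    by (auto simp: eventually_nhds_metric)
  \<comment> \<open>Two steps of length at most \<open>h\<close> stay strictly within distance
    \<open>r\<close> of \<open>x\<close>.\<close>
  define h where "h = r / 3"
  have "h > 0" using \<open>r > 0\<close> by (simp add: h_def)
  have near: "dist (x + s *\<^sub>R axis a 1 + t *\<^sub>R axis b 1) x < r"
    if "0 \<le> s" "s \<le> h" "0 \<le> t" "t \<le> h" for s t a b
  proof -
    have "dist (x + s *\<^sub>R axis a 1 + t *\<^sub>R axis b 1) x = norm (s *\<^sub>R axis a 1 + t *\<^sub>R axis b (1::real))"
      by (simp add: dist_norm algebra_simps)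
    also have "\<dots> \<le> norm (s *\<^sub>R axis a (1::real)) + norm (t *\<^sub>R axis b (1::real))"
      by (rule norm_triangle_ineq)
    also have "\<dots> < r"
      using that \<open>r > 0\<close> by (simp add: norm_eq_sqrt_inner inner_axis_axis h_def)
    finally show ?thesis .
  qed
  obtain s t where st: "0 < s" "s < h" "0 < t" "t < h"
    "f (x + h *\<^sub>R axis i 1 + h *\<^sub>R axis j 1) - f (x + h *\<^sub>R axis i 1) - f (x + h *\<^sub>R axis j 1) + f x
      = h\<^sup>2 * partial j (partial i f) (x + s *\<^sub>R axis i 1 + t *\<^sub>R axis j 1)"
    by (rule second_difference[OF \<open>h > 0\<close>, of x i j \<Omega> f]) (use near r f fi in blast)+
  obtain s' t' where st': "0 < s'" "s' < h" "0 < t'" "t' < h"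
    "f (x + h *\<^sub>R axis j 1 + h *\<^sub>R axis i 1) - f (x + h *\<^sub>R axis j 1) - f (x + h *\<^sub>R axis i 1) + f x
      = h\<^sup>2 * partial i (partial j f) (x + s' *\<^sub>R axis j 1 + t' *\<^sub>R axis i 1)"
    by (rule second_difference[OF \<open>h > 0\<close>, of x j i \<Omega> f]) (use near r f fj in blast)+
  have "h\<^sup>2 * partial j (partial i f) (x + s *\<^sub>R axis i 1 + t *\<^sub>R axis j 1)
      = h\<^sup>2 * partial i (partial j f) (x + s' *\<^sub>R axis j 1 + t' *\<^sub>R axis i 1)"
    unfolding st(5)[symmetric] st'(5)[symmetric] by (simp add: algebra_simps)
  then have "partial j (partial i f) (x + s *\<^sub>R axis i 1 + t *\<^sub>R axis j 1)
      = partial i (partial j f) (x + s' *\<^sub>R axis j 1 + t' *\<^sub>R axis i 1)"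
    using \<open>h > 0\<close> by simp
  moreover have "partial j (partial i f) (x + s *\<^sub>R axis i 1 + t *\<^sub>R axis j 1) < c"
    using st by (intro r[THEN conjunct2, THEN conjunct1] near) auto
  moreover have "c < partial i (partial j f) (x + s' *\<^sub>R axis j 1 + t' *\<^sub>R axis i 1)"
    using st' by (intro r[THEN conjunct2, THEN conjunct2] near) auto
  ultimately show False by simp
qed

section \<open>Locality of partials and closure properties of smooth functions\<close>

lemma partial_cong_open:
  assumes "open \<Omega>" "x \<in> \<Omega>" "\<And>y. y \<in> \<Omega> \<Longrightarrow> f y = g y"
  shows "partial i f x = partial i g x"
proof -
  \<comment> \<open>The coordinate line through \<open>x\<close> stays in \<open>\<Omega>\<close>
    for small \<open>t\<close>, and \<open>deriv\<close> at 0 sees only such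
    \<open>t\<close>.\<close>
  have "open ((\<lambda>t. x + t *\<^sub>R axis i 1) -` \<Omega>)"
    using assms(1) by (intro open_vimage continuous_intros)
  then have "\<forall>\<^sub>F t in nhds (0::real). x + t *\<^sub>R axis i 1 \<in> \<Omega>"
    using assms(2) by (auto dest: eventually_nhds_in_open[of _ 0])
  then have "\<forall>\<^sub>F t in nhds (0::real). f (x + t *\<^sub>R axis i 1) = g (x + t *\<^sub>R axis i 1)"
    by (rule eventually_mono) (use assms(3) in blast)
  then show ?thesis
    unfolding partial_def by (rule deriv_cong_ev) simp
qed

text \<open>Rules such as \<open>partial_add\<close> hold only at points of differentiability, that
  is on \<open>\<Omega>\<close>. Locality allows the rewritten partials to be put under the
  recursion of \<open>Ck_on\<close> nevertheless.\<close>

lemma Ck_on_cong: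
  assumes "open \<Omega>" "\<And>x. x \<in> \<Omega> \<Longrightarrow> f x = g x"
  shows "Ck_on k \<Omega> f \<longleftrightarrow> Ck_on k \<Omega> g"
  using assms(2)
proof (induction k arbitrary: f g)
  case 0
  then show ?case by (simp cong: continuous_on_cong)
next
  case (Suc k)
  have "f differentiable_on \<Omega> \<longleftrightarrow> g differentiable_on \<Omega>"
    unfolding differentiable_on_def differentiable_def
    using Suc.prems by (metis (no_types, lifting) has_derivative_transform)
  moreover have "Ck_on k \<Omega> (partial i f) \<longleftrightarrow> Ck_on k \<Omega> (partial i g)" for i
    by (rule Suc.IH) (use partial_cong_open[OF assms(1)] Suc.prems in blast)
  ultimately show ?case by simp
qed

lemma smooth_field_differentiable:
  assumes "open \<Omega>" "smooth_field \<Omega> f" "x \<in> \<Omega>"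
  shows "f differentiable at x"
proof -
  have "Ck_on (Suc 0) \<Omega> f" using assms by (simp only: smooth_field_def)
  then show ?thesis
    using assms by (simp add: differentiable_on_eq_differentiable_at)
qed

lemma smooth_field_partial: "smooth_field \<Omega> f \<Longrightarrow> smooth_field \<Omega> (partial i f)"
  unfolding smooth_field_def by (meson Ck_on.simps(2))

lemma Ck_on_add:
  assumes "open \<Omega>"
  shows "Ck_on k \<Omega> f \<Longrightarrow> Ck_on k \<Omega> g \<Longrightarrow> Ck_on k \<Omega> (\<lambda>x. f x + g x)"
proof (induction k arbitrary: f g)
  case 0
  then show ?case by (simp add: continuous_on_add)
next
  case (Suc k)
  have "Ck_on k \<Omega> (partial i (\<lambda>x. f x + g x)) \<longleftrightarrow> Ck_on k \<Omega> (\<lambda>x. partial i f x + partial i g x)" for i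
    by (rule Ck_on_cong[OF assms], rule partial_add)
       (use Suc.prems assms in \<open>auto simp: differentiable_on_eq_differentiable_at\<close>)
  then show ?case
    using Suc by (simp add: differentiable_on_def differentiable_add)
qed

lemma Ck_on_cmult:
  assumes "open \<Omega>"
  shows "Ck_on k \<Omega> f \<Longrightarrow> Ck_on k \<Omega> (\<lambda>x. c * f x)"
proof (induction k arbitrary: f)
  case 0
  then show ?case by (simp add: continuous_on_mult)
next
  case (Suc k)
  have "Ck_on k \<Omega> (partial i (\<lambda>x. c * f x)) \<longleftrightarrow> Ck_on k \<Omega> (\<lambda>x. c * partial i f x)" for i
    by (rule Ck_on_cong[OF assms], rule partial_cmult)
       (use Suc.prems assms in \<open>auto simp: differentiable_on_eq_differentiable_at\<close>)
  then show ?case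
    using Suc by (simp add: differentiable_on_def differentiable_mult)
qed

lemma Ck_on_const: "Ck_on k \<Omega> (\<lambda>x. c)"
proof (induction k arbitrary: c)
  case (Suc k)
  have "partial i (\<lambda>x. c) = (\<lambda>x. 0)" for i by (simp add: fun_eq_iff)
  with Suc show ?case by simp
qed simp

lemma smooth_field_const: "smooth_field \<Omega> (\<lambda>x. c)"
  by (simp add: smooth_field_def Ck_on_const)

lemma smooth_field_add:
  "open \<Omega> \<Longrightarrow> smooth_field \<Omega> f \<Longrightarrow> smooth_field \<Omega> g \<Longrightarrow> smooth_field \<Omega> (\<lambda>x. f x + g x)"
  by (simp add: smooth_field_def Ck_on_add)

lemma smooth_field_cmult:
  "open \<Omega> \<Longrightarrow> smooth_field \<Omega> f \<Longrightarrow> smooth_field \<Omega> (\<lambda>x. c * f x)"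
  by (simp add: smooth_field_def Ck_on_cmult)

lemma smooth_field_sum:
  assumes "open \<Omega>" "\<And>a. a \<in> I \<Longrightarrow> smooth_field \<Omega> (f a)"
  shows "smooth_field \<Omega> (\<lambda>x. \<Sum>a\<in>I. f a x)"
  using assms(2)
  by (induction I rule: infinite_finite_induct)
     (simp_all add: smooth_field_const smooth_field_add assms(1))

lemma partial_sum:
  assumes "\<And>a. a \<in> I \<Longrightarrow> f a differentiable at x"
  shows "partial i (\<lambda>x. \<Sum>a\<in>I. f a x) x = (\<Sum>a\<in>I. partial i (f a) x)"
  using assms
  by (induction I rule: infinite_finite_induct)
     (simp_all add: partial_add differentiable_sum)

text \<open>Smoothness makes both mixed partials continuous; neither can be smaller than the other,
  so they are equal.\<close>

lemma partial_commute:
  assumes "open \<Omega>" "smooth_field \<Omega> f" "x \<in> \<Omega>"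
  shows "partial i (partial j f) x = partial j (partial i f) x"
proof -
  have "isCont (partial a (partial b f)) x" for a b
    using assms by (intro differentiable_imp_continuous_within smooth_field_differentiable
        smooth_field_partial)
  moreover have "f differentiable at y" "partial a f differentiable at y" if "y \<in> \<Omega>" for y a
    using assms that by (auto intro: smooth_field_differentiable smooth_field_partial)
  ultimately have "\<not> partial a (partial b f) x < partial b (partial a f) x" for a b
    using assms by (intro mixed_partials_not_less) auto
  then show ?thesis by (metis linorder_neqE)
qed

text \<open>The total derivative vanishes on a convex set. The convexity of \<open>\<Omega>\<close>
  enters the theorem through this lemma alone.\<close>

lemma partials_zero_imp_eq:
  assumes "convex \<Omega>" and f: "\<And>x. x \<in> \<Omega> \<Longrightarrow> f differentiable at x"
    and "\<And>i x. x \<in> \<Omega> \<Longrightarrow> partial i f x = 0" and "x \<in> \<Omega>" "y \<in> \<Omega>"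
  shows "f x = f y"
proof -
  have "(f has_derivative (\<lambda>h. 0)) (at x within \<Omega>)" if "x \<in> \<Omega>" for x
    using has_derivative_partials[OF f[OF that]] assms(3)[OF that]
    by (simp add: has_derivative_at_withinI)
  from has_derivative_zero_constant[OF assms(1) this] assms(4,5) show ?thesis by metis
qed

section \<open>Quadratic functions\<close>

text \<open>For symmetric \<open>h\<close> the factor 1/2 makes \<open>h\<close> the Hessian and
  \<open>b\<close> the gradient at the origin. With \<open>h\<close> zero the same form describes
  affine functions, hence also the partials of quadratic ones.\<close>

definition quadratic :: "real \<Rightarrow> (3 \<Rightarrow> real) \<Rightarrow> (3 \<Rightarrow> 3 \<Rightarrow> real) \<Rightarrow> real^3 \<Rightarrow> real" where
  "quadratic a b h x =
     a + (\<Sum>i\<in>UNIV. b i * x $ i) + 1/2 * (\<Sum>i\<in>UNIV. \<Sum>j\<in>UNIV. h i j * x $ i * x $ j)"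

lemma quadratic_differentiable: "quadratic a b h differentiable at x"
proof -
  have "(\<lambda>x::real^3. x $ i) differentiable at x" for i
    by (rule bounded_linear_imp_differentiable[OF bounded_linear_vec_nth])
  then have "(\<lambda>x. quadratic a b h x) differentiable at x"
    unfolding quadratic_def
    by (intro differentiable_add differentiable_mult differentiable_sum differentiable_const) auto
  then show ?thesis by simp
qed

lemma partial_quadratic:
  assumes "\<And>i j. h i j = h j i"
  shows "partial i (quadratic a b h) = quadratic (b i) (h i) (\<lambda>_ _. 0)"
proof
  fix x
  show "partial i (quadratic a b h) x = quadratic (b i) (h i) (\<lambda>_ _. 0) x"
    unfolding partial_def quadratic_def sum_3
    by (rule DERIV_imp_deriv)
       (use assms[of 1 2] assms[of 1 3] assms[of 2 3] exhaust_3[of i] in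
        \<open>auto intro!: derivative_eq_intros simp: axis_def algebra_simps\<close>)
qed

lemma second_partial_quadratic:
  assumes "\<And>i j. h i j = h j i"
  shows "partial j (partial i (quadratic a b h)) = (\<lambda>x. h i j)"
  by (simp add: partial_quadratic assms) (simp add: fun_eq_iff quadratic_def)

text \<open>Integration from the top down: the second partials are constant, so each first partial
  is affine, so \<open>f\<close> is quadratic. At each level a candidate is subtracted and the
  difference has vanishing partials; its constant value is read off at a base point
  \<open>y\<close>.\<close>

lemma third_partials_zero_imp_quadratic:
  assumes "open \<Omega>" "convex \<Omega>" "smooth_field \<Omega> f" "\<Omega> \<noteq> {}"
    and third: "\<And>x i j k. x \<in> \<Omega> \<Longrightarrow> partial k (partial j (partial i f)) x = 0"
  obtains a b h where "\<And>i j. h i j = h j i" "\<And>x. x \<in> \<Omega> \<Longrightarrow> f x = quadratic a b h x"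
proof -
  obtain y where y: "y \<in> \<Omega>" using assms(4) by blast
  note diff = smooth_field_differentiable[OF assms(1)]
  have fi: "smooth_field \<Omega> (partial i f)" for i
    by (rule smooth_field_partial[OF assms(3)])
  note eq = partials_zero_imp_eq[OF assms(2) _ _ _ y]
  define h where "h i j = partial j (partial i f) y" for i j
  have h: "partial j (partial i f) x = h i j" if "x \<in> \<Omega>" for i j x
    unfolding h_def by (rule eq[OF _ _ that]) (auto intro: diff smooth_field_partial assms)
  have sym: "h i j = h j i" for i j
    unfolding h_def by (rule partial_commute[OF assms(1,3) y])
  define b where "b i = partial i f y - quadratic 0 (h i) (\<lambda>_ _. 0) y" for i
  have b': "partial i f x - quadratic 0 (h i) (\<lambda>_ _. 0) x = b i" if "x \<in> \<Omega>" for i x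
    unfolding b_def
    by (rule eq[OF _ _ that])
       (auto intro!: differentiable_diff quadratic_differentiable diff[OF fi]
         simp: partial_diff partial_quadratic h diff[OF fi] quadratic_differentiable,
        simp add: quadratic_def)
  have b: "partial i f x = quadratic (b i) (h i) (\<lambda>_ _. 0) x" if "x \<in> \<Omega>" for i x
    using b'[OF that, of i] by (simp add: quadratic_def)
  define a where "a = f y - quadratic 0 b h y"
  have a: "f x - quadratic 0 b h x = a" if "x \<in> \<Omega>" for x
    unfolding a_def
    by (rule eq[OF _ _ that])
       (auto intro!: differentiable_diff quadratic_differentiable diff[OF assms(3)]
         simp: partial_diff partial_quadratic sym b diff[OF assms(3)] quadratic_differentiable)
  have "f x = quadratic a b h x" if "x \<in> \<Omega>" for x
    using a[OF that] by (simp add: quadratic_def)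
  with sym show thesis by (rule that)
qed

section \<open>The equilibrium equations\<close>

lemma smooth_field_strain:
  assumes "open \<Omega>" "displacement_field \<Omega> u"
  shows "smooth_field \<Omega> (strain u l m)"
  using assms unfolding strain_def displacement_field_def
  by (intro smooth_field_cmult smooth_field_add smooth_field_partial) auto

lemma partial_strain:
  assumes "open \<Omega>" "displacement_field \<Omega> u" "x \<in> \<Omega>"
  shows "partial j (strain u l m) x =
    1/2 * (partial j (partial m (\<lambda>y. u y $ l)) x + partial j (partial l (\<lambda>y. u y $ m)) x)"
proof -
  have "partial a (\<lambda>y. u y $ b) differentiable at x" for a b
    using assms unfolding displacement_field_def
    by (blast intro: smooth_field_differentiable smooth_field_partial)
  then show ?thesis
    unfolding strain_def by (simp only: partial_cmult partial_add differentiable_add)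
qed

text \<open>Smoothness permits differentiation term by term. Afterwards the material tensors appear
  only as constant coefficients of partials of the strain.\<close>

lemma equilibrium_iff:
  assumes "open \<Omega>" "displacement_field \<Omega> u"
  shows "equilibrium \<Omega> (C, M, A) u \<longleftrightarrow> (\<forall>x\<in>\<Omega>. \<forall>i.
    (\<Sum>j\<in>UNIV.
      (\<Sum>l\<in>UNIV. \<Sum>m\<in>UNIV. C i j l m * partial j (strain u l m) x) +
      (\<Sum>l\<in>UNIV. \<Sum>m\<in>UNIV. \<Sum>n\<in>UNIV. M i j l m n * partial j (partial n (strain u l m)) x)) -
    (\<Sum>j\<in>UNIV. \<Sum>k\<in>UNIV.
      (\<Sum>l\<in>UNIV. \<Sum>m\<in>UNIV. M l m i j k * partial k (partial j (strain u l m)) x) +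
      (\<Sum>l\<in>UNIV. \<Sum>m\<in>UNIV. \<Sum>n\<in>UNIV.
        A i j k l m n * partial k (partial j (partial n (strain u l m))) x)) = 0)"
proof -
  note smooth = smooth_field_cmult[OF assms(1)] smooth_field_sum[OF assms(1)]
    smooth_field_partial smooth_field_strain[OF assms]
  note diff = smooth_field_differentiable[OF assms(1)]
  note partial_simps = partial_add partial_sum partial_cmult differentiable_sum diff[rotated] smooth
  have stress: "partial j (stress C M u i j) x =
      (\<Sum>l\<in>UNIV. \<Sum>m\<in>UNIV. C i j l m * partial j (strain u l m) x) +
      (\<Sum>l\<in>UNIV. \<Sum>m\<in>UNIV. \<Sum>n\<in>UNIV. M i j l m n * partial j (partial n (strain u l m)) x)"
    if "x \<in> \<Omega>" for x i j
    using that unfolding stress_def by (simp add: partial_simps)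
  have hyper: "partial j (hyperstress M A u i j k) x =
      (\<Sum>l\<in>UNIV. \<Sum>m\<in>UNIV. M l m i j k * partial j (strain u l m) x) +
      (\<Sum>l\<in>UNIV. \<Sum>m\<in>UNIV. \<Sum>n\<in>UNIV. A i j k l m n * partial j (partial n (strain u l m)) x)"
    if "x \<in> \<Omega>" for x i j k
    using that unfolding hyperstress_def by (simp add: partial_simps)
  \<comment> \<open>The formula \<open>hyper\<close> is known on \<open>\<Omega>\<close> only, so
    locality is needed to differentiate it once more.\<close>
  have hyper2: "partial k (partial j (hyperstress M A u i j k)) x =
      (\<Sum>l\<in>UNIV. \<Sum>m\<in>UNIV. M l m i j k * partial k (partial j (strain u l m)) x) +
      (\<Sum>l\<in>UNIV. \<Sum>m\<in>UNIV. \<Sum>n\<in>UNIV.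
        A i j k l m n * partial k (partial j (partial n (strain u l m))) x)"
    if "x \<in> \<Omega>" for x i j k
    by (rule trans[OF partial_cong_open[OF assms(1) that hyper]], assumption)
       (use that in \<open>simp add: partial_simps\<close>)
  show ?thesis
    by (simp add: equilibrium_def stress hyper2)
qed

section \<open>Tetragonal symmetry\<close>

text \<open>Row \<open>i\<close> has its only possibly nonzero entry in column \<open>p i\<close>.
  The sums over all index tuples in the invariance conditions therefore collapse to a single term:
  indices are moved by \<open>p\<close> and signs multiply.\<close>

definition signed_perm :: "(3 \<Rightarrow> real) \<Rightarrow> (3 \<Rightarrow> 3) \<Rightarrow> real^3^3" where
  "signed_perm s p = (\<chi> i j. if j = p i then s i else 0)"

definition swap12 :: "3 \<Rightarrow> 3" where
  "swap12 i = (if i = 1 then 2 else if i = 2 then 1 else i)"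

lemma swap12_simps [simp]: "swap12 1 = 2" "swap12 2 = 1" "swap12 3 = 3"
  by (simp_all add: swap12_def)

lemma swap12_swap12 [simp]: "swap12 (swap12 i) = i"
  by (simp add: swap12_def)

lemma signed_perm_sum: "(\<Sum>j\<in>UNIV. signed_perm s p $ i $ j * F j) = s i * F (p i)"
  by (simp add: signed_perm_def if_distrib[of "\<lambda>a. a * _"] cong: if_cong)

lemma signed_perm_mult:
  "signed_perm s p ** signed_perm s' p' = signed_perm (\<lambda>i. s i * s' (p i)) (p' \<circ> p)"
  by (simp add: vec_eq_iff matrix_matrix_mult_def signed_perm_sum) (simp add: signed_perm_def)

lemma transpose_signed_perm:
  assumes "\<And>i. p (p i) = i"
  shows "transpose (signed_perm s p) = signed_perm (s \<circ> p) p"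
  using assms by (auto simp: vec_eq_iff transpose_def signed_perm_def)

lemma mat_1_eq_signed_perm: "mat 1 = signed_perm (\<lambda>_. 1) id"
  by (simp add: vec_eq_iff mat_def signed_perm_def)

lemma signed_perm_orthogonal:
  assumes "\<And>i. p (p i) = i" "\<And>i. s i = 1 \<or> s i = -1"
  shows "orthogonal_matrix (signed_perm s p)"
proof -
  have "s i * s i = 1" for i using assms(2)[of i] by auto
  then show ?thesis
    by (simp add: orthogonal_matrix transpose_signed_perm assms(1) signed_perm_mult
        mat_1_eq_signed_perm) (simp add: signed_perm_def vec_eq_iff assms(1))
qed

lemma signed_perm_action4:
  "(\<Sum>j1\<in>UNIV. \<Sum>j2\<in>UNIV. \<Sum>j3\<in>UNIV. \<Sum>j4\<in>UNIV.
      signed_perm s p $ i1 $ j1 * signed_perm s p $ i2 $ j2 * signed_perm s p $ i3 $ j3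
      * signed_perm s p $ i4 $ j4 * T j1 j2 j3 j4)
    = s i1 * s i2 * s i3 * s i4 * T (p i1) (p i2) (p i3) (p i4)"
  by (simp add: mult.assoc signed_perm_sum flip: sum_distrib_left)

lemma signed_perm_action5:
  "(\<Sum>j1\<in>UNIV. \<Sum>j2\<in>UNIV. \<Sum>j3\<in>UNIV. \<Sum>j4\<in>UNIV. \<Sum>j5\<in>UNIV.
      signed_perm s p $ i1 $ j1 * signed_perm s p $ i2 $ j2 * signed_perm s p $ i3 $ j3
      * signed_perm s p $ i4 $ j4 * signed_perm s p $ i5 $ j5 * T j1 j2 j3 j4 j5)
    = s i1 * s i2 * s i3 * s i4 * s i5 * T (p i1) (p i2) (p i3) (p i4) (p i5)"
  by (simp add: mult.assoc signed_perm_sum flip: sum_distrib_left)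

text \<open>
  The point groups of order 16 and 8 in Schoenflies notation.  \<open>D4h\<close> is \<open>\<D>\<^sub>4 \<oplus> \<int>\<^sub>2\<^sup>c\<close>;
  the test tensor for \<open>M\<close> happens to be invariant under \<open>C4v\<close>, which contains \<open>\<int>\<^sub>4\<close>.
\<close>

definition D4h :: "(real^3^3) set" where
  "D4h = {signed_perm s p | s p. (\<forall>i. s i = 1 \<or> s i = -1) \<and> (p = id \<or> p = swap12)}"

definition C4v :: "(real^3^3) set" where
  "C4v = {Q \<in> D4h. Q $ 3 $ 3 = 1}"

lemma D4h_cases:
  assumes "Q \<in> D4h"
  obtains s p where "Q = signed_perm s p" "\<And>i. s i = 1 \<or> s i = -1" "p = id \<or> p = swap12"
    "\<And>i. p (p i) = i" "p 3 = 3" "Q $ 3 $ 3 = s 3"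
  using assms by (fastforce simp: D4h_def signed_perm_def)

lemma signed_perm_in_D4h:
  assumes "\<And>i. s i = 1 \<or> s i = -1" "p = id \<or> p = swap12"
  shows "signed_perm s p \<in> D4h"
  using assms unfolding D4h_def by blast

lemma D4h_orthogonal: "Q \<in> D4h \<Longrightarrow> orthogonal_matrix Q"
  by (erule D4h_cases) (simp add: signed_perm_orthogonal)

text \<open>All these matrices preserve the third axis, so the entry 3 3 is multiplicative; this
  makes \<open>C4v\<close> closed under products.\<close>

lemma D4h_mult:
  assumes "P \<in> D4h" "Q \<in> D4h"
  shows "P ** Q \<in> D4h" and "(P ** Q) $ 3 $ 3 = P $ 3 $ 3 * Q $ 3 $ 3"
proof -
  obtain s p where P: "P = signed_perm s p" "\<And>i. s i = 1 \<or> s i = -1" "p = id \<or> p = swap12"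
    "p 3 = 3"
    using assms(1) by (blast elim: D4h_cases)
  obtain t q where Q: "Q = signed_perm t q" "\<And>i. t i = 1 \<or> t i = -1" "q = id \<or> q = swap12"
    "q 3 = 3"
    using assms(2) by (blast elim: D4h_cases)
  have "q \<circ> p = id \<or> q \<circ> p = swap12"
    using P(3) Q(3) by (auto simp: fun_eq_iff)
  moreover have "s i * t (p i) = 1 \<or> s i * t (p i) = -1" for i
    using P(2)[of i] Q(2)[of "p i"] by auto
  ultimately show "P ** Q \<in> D4h"
    unfolding P(1) Q(1) signed_perm_mult by (intro signed_perm_in_D4h)
  show "(P ** Q) $ 3 $ 3 = P $ 3 $ 3 * Q $ 3 $ 3"
    unfolding P(1) Q(1) signed_perm_mult using P(4) Q(4) by (simp add: signed_perm_def)
qed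

lemma D4h_transpose: "Q \<in> D4h \<Longrightarrow> transpose Q \<in> D4h"
  by (erule D4h_cases) (simp add: transpose_signed_perm signed_perm_in_D4h)

section \<open>The explicit matrix groups and the generated groups\<close>

lemma inv_O3:
  assumes "orthogonal_matrix Q"
  shows "inv\<^bsub>O3\<^esub> Q = transpose Q"
  using assms
  by (intro group.inv_equality[OF group_O3]) (simp_all add: O3_def orthogonal_matrix_def)

lemma subgroup_D4h: "subgroup D4h O3"
proof (rule group.subgroupI[OF group_O3])
  show "D4h \<subseteq> carrier O3" by (auto simp: O3_def D4h_orthogonal)
  show "D4h \<noteq> {}" using signed_perm_in_D4h[of "\<lambda>_. 1" id] by auto
next
  fix Q assume "Q \<in> D4h"
  then show "inv\<^bsub>O3\<^esub> Q \<in> D4h" by (simp add: inv_O3 D4h_orthogonal D4h_transpose)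
next
  fix P Q assume "P \<in> D4h" "Q \<in> D4h"
  then show "P \<otimes>\<^bsub>O3\<^esub> Q \<in> D4h" by (simp add: O3_def D4h_mult)
qed

lemma subgroup_C4v: "subgroup C4v O3"
proof (rule group.subgroupI[OF group_O3])
  show "C4v \<subseteq> carrier O3" by (auto simp: O3_def C4v_def D4h_orthogonal)
  have "mat 1 \<in> C4v"
    by (simp add: C4v_def mat_1_eq_signed_perm signed_perm_in_D4h) (simp add: signed_perm_def)
  then show "C4v \<noteq> {}" by blast
next
  fix Q assume "Q \<in> C4v"
  then show "inv\<^bsub>O3\<^esub> Q \<in> C4v"
    by (simp add: C4v_def inv_O3 D4h_orthogonal D4h_transpose) (simp add: transpose_def)
next
  fix P Q assume "P \<in> C4v" "Q \<in> C4v"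
  then show "P \<otimes>\<^bsub>O3\<^esub> Q \<in> C4v" by (simp add: O3_def C4v_def D4h_mult)
qed

lemma rot_e3_eq_signed_perm: "rot_e3 (pi/2) = signed_perm (\<lambda>i. if i = 1 then -1 else 1) swap12"
  by (simp add: vec_eq_iff forall_3 rot_e3_def signed_perm_def vector_3)

lemma rot_e1_eq_signed_perm: "rot_e1 pi = signed_perm (\<lambda>i. if i = 1 then 1 else -1) id"
  by (simp add: vec_eq_iff forall_3 rot_e1_def signed_perm_def vector_3)

lemma Z4_subset_C4v: "Z4 \<subseteq> C4v"
proof -
  have "rot_e3 (pi/2) \<in> C4v"
    by (simp add: C4v_def rot_e3_eq_signed_perm signed_perm_in_D4h) (simp add: signed_perm_def)
  then show ?thesis
    unfolding Z4_def
    by (intro group.generate_subgroup_incl[OF group_O3 _ subgroup_C4v]) simp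
qed

text \<open>This inclusion transfers invariance from the explicit group to the generated one, which
  places test tensors in the class. The converse use of invariance, to restrict a given tensor, goes
  through two generators.\<close>

lemma plus_Z2c_D4_subset_D4h: "plus_Z2c D4 \<subseteq> D4h"
proof -
  have "rot_e1 pi \<in> D4h" "mat 1 \<in> D4h"
    by (simp_all add: rot_e1_eq_signed_perm mat_1_eq_signed_perm signed_perm_in_D4h)
  moreover have "- mat 1 = signed_perm (\<lambda>_. -1) id"
    by (simp add: vec_eq_iff mat_def signed_perm_def)
  then have "- mat 1 \<in> D4h"
    by (simp add: signed_perm_in_D4h)
  moreover have "Z4 \<subseteq> D4h"
    using Z4_subset_C4v by (auto simp: C4v_def)
  ultimately show ?thesis
    unfolding plus_Z2c_def D4_def Z2c_def
    by (intro group.generate_subgroup_incl[OF group_O3 _ subgroup_D4h] Un_least) auto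
qed

lemma generators_in_plus_Z2c_D4: "rot_e3 (pi/2) \<in> plus_Z2c D4" "rot_e1 pi \<in> plus_Z2c D4"
  unfolding plus_Z2c_def D4_def Z4_def by (auto intro!: generate.incl)

text \<open>The stiffness of tetragonal elasticity in Voigt notation: the pairs 11, 22, 33, 23, 13,
  12 are numbered 1 to 6, with c22 = c11, c23 = c13 and c55 = c44.\<close>

definition stiffness :: "real \<Rightarrow> real \<Rightarrow> real \<Rightarrow> real \<Rightarrow> real \<Rightarrow> real \<Rightarrow> tensor4" where
  "stiffness c11 c33 c12 c13 c44 c66 i j l m =
     (if i = j \<and> l = m then
        if i = l then if i = 3 then c33 else c11
        else if i = 3 \<or> l = 3 then c13 else c12
      else if i = l \<and> j = m \<or> i = m \<and> j = l then
        if i = 3 \<or> j = 3 then c44 else c66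
      else 0)"

text \<open>
  The entries 13111, 31111, 23222 and 32222.  Only \<open>M\<^sub>l\<^sub>m\<^sub>i\<^sub>j\<^sub>k e\<^sub>l\<^sub>m\<^sub>,\<^sub>j\<^sub>k\<close> then involves \<open>u\<^sub>3\<close>,
  through \<open>u\<^sub>3\<^sub>,\<^sub>1\<^sub>1\<^sub>1\<close> for \<open>i = 1\<close> and \<open>u\<^sub>3\<^sub>,\<^sub>2\<^sub>2\<^sub>2\<close> for \<open>i = 2\<close>.
\<close>

definition coupling :: tensor5 where
  "coupling i j k l m =
     (if (i = 3 \<and> j \<noteq> 3 \<and> k = j \<or> j = 3 \<and> i \<noteq> 3 \<and> k = i) \<and> l = k \<and> m = k then 1 else 0)"

text \<open>A nonzero entry has its indices equal in pairs, so the signs cancel. Its value depends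
  only on which indices coincide and which equal 3, and \<open>p\<close> preserves both.\<close>

lemma stiffness_in_class:
  "(stiffness c11 c33 c12 c13 c44 c66, \<lambda>_ _ _ _ _. 0, \<lambda>_ _ _ _ _ _. 0) \<in> tetragonal_class_Z4"
proof -
  let ?C = "stiffness c11 c33 c12 c13 c44 c66"
  have "invariant4 D4h ?C"
    unfolding invariant4_def
  proof (intro ballI allI)
    fix Q i1 i2 i3 i4 assume "Q \<in> D4h"
    then obtain s p where Q: "Q = signed_perm s p" and s: "\<And>i. s i = 1 \<or> s i = -1"
      and pp: "\<And>i. p (p i) = i" and p3: "p 3 = 3"
      by (blast elim: D4h_cases)
    have p: "p i = p j \<longleftrightarrow> i = j" "p i = 3 \<longleftrightarrow> i = 3" for i j
      using pp p3 by metis+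
    have "s i1 * s i2 * s i3 * s i4 = 1" if "?C i1 i2 i3 i4 \<noteq> 0"
    proof -
      have "i1 = i2 \<and> i3 = i4 \<or> i1 = i3 \<and> i2 = i4 \<or> i1 = i4 \<and> i2 = i3"
        using that by (auto simp: stiffness_def split: if_splits)
      then show ?thesis
        using s[of i1] s[of i2] s[of i3] s[of i4] by auto
    qed
    moreover have "?C (p i1) (p i2) (p i3) (p i4) = ?C i1 i2 i3 i4"
      by (simp only: stiffness_def p)
    ultimately have "s i1 * s i2 * s i3 * s i4 * ?C (p i1) (p i2) (p i3) (p i4) = ?C i1 i2 i3 i4"
      by (metis mult_1 mult_zero_right)
    then show "(\<Sum>j1\<in>UNIV. \<Sum>j2\<in>UNIV. \<Sum>j3\<in>UNIV. \<Sum>j4\<in>UNIV.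
        Q $ i1 $ j1 * Q $ i2 $ j2 * Q $ i3 $ j3 * Q $ i4 $ j4 * ?C j1 j2 j3 j4) = ?C i1 i2 i3 i4"
      unfolding Q signed_perm_action4 .
  qed
  then have "invariant4 (plus_Z2c D4) ?C"
    using plus_Z2c_D4_subset_D4h unfolding invariant4_def by blast
  moreover have "\<forall>i j l m. ?C i j l m = ?C j i l m \<and> ?C i j l m = ?C l m i j"
    by (simp add: forall_3 stiffness_def)
  ultimately show ?thesis
    by (simp add: tetragonal_class_Z4_def strain_gradient_material_def invariant5_def
        invariant6_def)
qed

text \<open>A nonzero entry has one index 3, whose sign is 1 on \<open>C4v\<close>, and four further
  indices that are equal, so that their signs cancel.\<close>

lemma coupling_in_class:
  "(\<lambda>_ _ _ _. 0, coupling, \<lambda>_ _ _ _ _ _. 0) \<in> tetragonal_class_Z4"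
proof -
  have "invariant5 C4v coupling"
    unfolding invariant5_def
  proof (intro ballI allI)
    fix Q i1 i2 i3 i4 i5 assume "Q \<in> C4v"
    then have "Q \<in> D4h" "Q $ 3 $ 3 = 1" by (auto simp: C4v_def)
    then obtain s p where Q: "Q = signed_perm s p" and s: "\<And>i. s i = 1 \<or> s i = -1"
      and pp: "\<And>i. p (p i) = i" and p3: "p 3 = 3" and s3: "s 3 = 1"
      by (metis D4h_cases)
    have ss: "s i * s i = 1" "s i * (s i * a) = a" for i a using s[of i] by auto
    have p: "p i = p j \<longleftrightarrow> i = j" "p i = 3 \<longleftrightarrow> i = 3" for i j
      using pp p3 by metis+
    have "s i1 * s i2 * s i3 * s i4 * s i5 * coupling (p i1) (p i2) (p i3) (p i4) (p i5)
        = coupling i1 i2 i3 i4 i5"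
      by (auto simp: coupling_def p p3 ss s3 mult.assoc)
    then show "(\<Sum>j1\<in>UNIV. \<Sum>j2\<in>UNIV. \<Sum>j3\<in>UNIV. \<Sum>j4\<in>UNIV. \<Sum>j5\<in>UNIV.
        Q $ i1 $ j1 * Q $ i2 $ j2 * Q $ i3 $ j3 * Q $ i4 $ j4 * Q $ i5 $ j5
          * coupling j1 j2 j3 j4 j5) = coupling i1 i2 i3 i4 i5"
      unfolding Q signed_perm_action5 .
  qed
  then have "invariant5 Z4 coupling"
    using Z4_subset_C4v unfolding invariant5_def by blast
  moreover have "coupling i j k l m = coupling j i k l m" "coupling i j k l m = coupling i j l k m"
    for i j k l m
    by (auto simp: coupling_def)
  ultimately show ?thesis
    by (simp add: tetragonal_class_Z4_def strain_gradient_material_def invariant4_def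
        invariant6_def)
qed

text \<open>The half turns about the axes 1 and 3 leave only entries in which each index occurs an
  even number of times. The quarter turn identifies entries that differ by exchanging 1 and 2, and
  the index symmetries do the rest.\<close>

lemma invariant_eq_stiffness:
  assumes C: "\<And>i j l m. C i j l m = C j i l m" "\<And>i j l m. C i j l m = C l m i j"
    and inv: "invariant4 (plus_Z2c D4) C"
  shows "C = stiffness (C 1 1 1 1) (C 3 3 3 3) (C 1 1 2 2) (C 1 1 3 3) (C 1 3 1 3) (C 1 2 1 2)"
proof -
  \<comment> \<open>\<open>r\<close> is the sign vector of the quarter turn about axis 3, and
    \<open>- r\<close> is that of the half turn about axis 1.\<close>
  define r where "r = (\<lambda>i::3. if i = 1 then -1 else 1 :: real)"
  have minor: "C i j m l = C i j l m" for i j l m by (metis C)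
  have R: "r i * r j * r l * r m * C (swap12 i) (swap12 j) (swap12 l) (swap12 m) = C i j l m"
    for i j l m
    using bspec[OF inv[unfolded invariant4_def] generators_in_plus_Z2c_D4(1)]
    unfolding rot_e3_eq_signed_perm signed_perm_action4 r_def by blast
  have S: "(- r i) * (- r j) * (- r l) * (- r m) * C i j l m = C i j l m" for i j l m
  proof -
    have "- r i = (if i = 1 then 1 else -1)" for i by (simp add: r_def)
    then show ?thesis
      using bspec[OF inv[unfolded invariant4_def] generators_in_plus_Z2c_D4(2)]
      unfolding rot_e1_eq_signed_perm signed_perm_action4 id_apply by presburger
  qed
  have "C 2 3 2 3 = C 1 3 1 3" "C 2 2 3 3 = C 1 1 3 3"
    using R[of 2 3 2 3] R[of 2 2 3 3] by (simp_all add: r_def)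
  then have eqs: "C 2 3 2 3 = C 1 3 1 3" "C 3 1 1 3 = C 1 3 1 3" "C 3 2 2 3 = C 1 3 1 3"
    "C 3 2 3 2 = C 1 3 1 3" "C 2 2 3 3 = C 1 1 3 3"
    by (metis C(1) minor)+
  \<comment> \<open>All index tuples are checked. The two instances of \<open>R\<close> compose to
    the half turn about axis 3, which removes entries with an odd number of indices 3;
    \<open>S\<close> removes those with an odd number of indices 1.\<close>
  have "C i j l m = stiffness (C 1 1 1 1) (C 3 3 3 3) (C 1 1 2 2) (C 1 1 3 3) (C 1 3 1 3) (C 1 2 1 2) i j l m"
    for i j l m
    using R[of i j l m] R[of "swap12 i" "swap12 j" "swap12 l" "swap12 m"] S[of i j l m]
      C(1)[of i j l m] C(2)[of i j l m] C(1)[of l m i j] minor[of i j l m]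
      exhaust_3[of i] exhaust_3[of j] exhaust_3[of l] exhaust_3[of m]
    by (elim disjE) (simp_all add: stiffness_def r_def, simp_all (no_asm) add: eqs)
  then show ?thesis by (intro ext)
qed

section \<open>Universal displacements\<close>

lemma smooth_component: "displacement_field \<Omega> u \<Longrightarrow> smooth_field \<Omega> (\<lambda>y. u y $ l)"
  by (simp add: displacement_field_def)

text \<open>The elastic part of equilibrium, sorted by material constant, where
  \<open>U l i j\<close> stands for u_l,ij. Both directions of the theorem read their relations
  between second partials off this form.\<close>

lemma stiffness_divergence:
  fixes u :: "real^3 \<Rightarrow> real^3" and x :: "real^3" and c11 c33 c12 c13 c44 c66 :: real
  assumes "open \<Omega>" "displacement_field \<Omega> u" "x \<in> \<Omega>"
  defines "U \<equiv> \<lambda>l i j. partial i (partial j (\<lambda>y. u y $ l)) x"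
    and "f \<equiv> \<lambda>i. \<Sum>j\<in>UNIV. \<Sum>l\<in>UNIV. \<Sum>m\<in>UNIV.
      stiffness c11 c33 c12 c13 c44 c66 i j l m * partial j (strain u l m) x"
  shows "f 1 = c11 * U 1 1 1 + c12 * U 2 1 2 + c13 * U 3 1 3
      + c66 * (U 1 2 2 + U 2 1 2) + c44 * (U 1 3 3 + U 3 1 3)"
    and "f 2 = c11 * U 2 2 2 + c12 * U 1 1 2 + c13 * U 3 2 3
      + c66 * (U 1 1 2 + U 2 1 1) + c44 * (U 2 3 3 + U 3 2 3)"
    and "f 3 = c33 * U 3 3 3 + c13 * (U 1 1 3 + U 2 2 3)
      + c44 * (U 1 1 3 + U 3 1 1 + U 2 2 3 + U 3 2 2)"
proof -
  have commute: "U l 2 1 = U l 1 2" "U l 3 1 = U l 1 3" "U l 3 2 = U l 2 3" for l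
    unfolding U_def
    by (rule partial_commute[OF assms(1) smooth_component[OF assms(2)] assms(3)])+
  have strain: "partial j (strain u l m) x = 1/2 * (U l j m + U m j l)" for j l m
    unfolding U_def by (rule partial_strain[OF assms(1-3)])
  show "f 1 = c11 * U 1 1 1 + c12 * U 2 1 2 + c13 * U 3 1 3
      + c66 * (U 1 2 2 + U 2 1 2) + c44 * (U 1 3 3 + U 3 1 3)"
    "f 2 = c11 * U 2 2 2 + c12 * U 1 1 2 + c13 * U 3 2 3
      + c66 * (U 1 1 2 + U 2 1 1) + c44 * (U 2 3 3 + U 3 2 3)"
    "f 3 = c33 * U 3 3 3 + c13 * (U 1 1 3 + U 2 2 3)
      + c44 * (U 1 1 3 + U 3 1 1 + U 2 2 3 + U 3 2 2)"
    by (simp_all add: f_def strain sum_3 stiffness_def commute) (simp_all add: field_simps)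
qed

section \<open>Second and third partials of universal fields\<close>

lemma partial_zero_on_open:
  assumes "open \<Omega>" "x \<in> \<Omega>" "\<And>y. y \<in> \<Omega> \<Longrightarrow> f y = c"
  shows "partial k f x = 0"
  using partial_cong_open[OF assms(1,2), of f "\<lambda>_. c" k] assms(3) by simp

text \<open>The two adjacent transpositions generate all permutations of the three indices.\<close>

lemma third_partial_commute:
  assumes "open \<Omega>" "smooth_field \<Omega> f" "x \<in> \<Omega>"
  shows "partial k (partial j (partial i f)) x = partial j (partial k (partial i f)) x"
    and "partial k (partial j (partial i f)) x = partial k (partial i (partial j f)) x"
   by (rule partial_commute[OF assms(1) smooth_field_partial[OF assms(2)] assms(3)],
       rule partial_cong_open[OF assms(1,3)], rule partial_commute[OF assms(1,2)])

lemma partial_partial_strain: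
  assumes "open \<Omega>" "displacement_field \<Omega> u" "x \<in> \<Omega>"
  shows "partial k (partial j (strain u l m)) x =
    1/2 * (partial k (partial j (partial m (\<lambda>y. u y $ l))) x +
           partial k (partial j (partial l (\<lambda>y. u y $ m))) x)"
proof -
  have diff: "partial c (partial a (\<lambda>y. u y $ b)) differentiable at x" for a b c
    using assms by (blast intro: smooth_field_differentiable smooth_field_partial smooth_component)
  have "partial k (partial j (strain u l m)) x = partial k (\<lambda>x.
      1/2 * (partial j (partial m (\<lambda>y. u y $ l)) x + partial j (partial l (\<lambda>y. u y $ m)) x)) x"
    by (rule partial_cong_open[OF assms(1,3)], rule partial_strain[OF assms(1,2)])
  then show ?thesis
    by (simp only: partial_cmult partial_add differentiable_add diff)
qed

lemma universal_second_partials: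
  fixes u :: "real^3 \<Rightarrow> real^3" and x :: "real^3"
  assumes "open \<Omega>" "displacement_field \<Omega> u" "universal \<Omega> tetragonal_class_Z4 u" "x \<in> \<Omega>"
  defines "U \<equiv> \<lambda>l i j. partial i (partial j (\<lambda>y. u y $ l)) x"
  shows "U 1 1 1 = 0" "U 1 2 2 = 0" "U 1 3 3 = 0" "U 1 1 2 = 0"
    and "U 2 1 1 = 0" "U 2 2 2 = 0" "U 2 3 3 = 0" "U 2 1 2 = 0" "U 1 1 3 + U 2 2 3 = 0"
    and "U 3 3 3 = 0" "U 3 1 3 = 0" "U 3 2 3 = 0" "U 3 1 1 + U 3 2 2 = 0"
proof -
  have E: "c11 * U 1 1 1 + c12 * U 2 1 2 + c13 * U 3 1 3
      + c66 * (U 1 2 2 + U 2 1 2) + c44 * (U 1 3 3 + U 3 1 3) = 0"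
    "c11 * U 2 2 2 + c12 * U 1 1 2 + c13 * U 3 2 3
      + c66 * (U 1 1 2 + U 2 1 1) + c44 * (U 2 3 3 + U 3 2 3) = 0"
    "c33 * U 3 3 3 + c13 * (U 1 1 3 + U 2 2 3)
      + c44 * (U 1 1 3 + U 3 1 1 + U 2 2 3 + U 3 2 2) = 0"
    for c11 c33 c12 c13 c44 c66
  proof -
    have "equilibrium \<Omega> (stiffness c11 c33 c12 c13 c44 c66, \<lambda>_ _ _ _ _. 0, \<lambda>_ _ _ _ _ _. 0) u"
      using assms(3) stiffness_in_class unfolding universal_def by blast
    then have "(\<Sum>j\<in>UNIV. \<Sum>l\<in>UNIV. \<Sum>m\<in>UNIV.
        stiffness c11 c33 c12 c13 c44 c66 i j l m * partial j (strain u l m) x) = 0" for i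
      using assms(4) unfolding equilibrium_iff[OF assms(1,2)] by simp
    from this[of 1] this[of 2] this[of 3]
    show "c11 * U 1 1 1 + c12 * U 2 1 2 + c13 * U 3 1 3
      + c66 * (U 1 2 2 + U 2 1 2) + c44 * (U 1 3 3 + U 3 1 3) = 0"
    "c11 * U 2 2 2 + c12 * U 1 1 2 + c13 * U 3 2 3
      + c66 * (U 1 1 2 + U 2 1 1) + c44 * (U 2 3 3 + U 3 2 3) = 0"
    "c33 * U 3 3 3 + c13 * (U 1 1 3 + U 2 2 3)
      + c44 * (U 1 1 3 + U 3 1 1 + U 2 2 3 + U 3 2 2) = 0"
      unfolding stiffness_divergence[OF assms(1,2,4)] U_def by blast+
  qed
  \<comment> \<open>Each instance sets one constant to 1 and the others to 0, in the order of
    occurrence: c11, c12, c13, c66, c44 in the first two equations and c33, c13, c44 in the third.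
    The relations from c12 and c13 simplify those from c66 and c44.\<close>
  show "U 1 1 1 = 0" "U 1 2 2 = 0" "U 1 3 3 = 0" "U 1 1 2 = 0"
    "U 2 1 1 = 0" "U 2 2 2 = 0" "U 2 3 3 = 0" "U 2 1 2 = 0" "U 1 1 3 + U 2 2 3 = 0"
    "U 3 3 3 = 0" "U 3 1 3 = 0" "U 3 2 3 = 0" "U 3 1 1 + U 3 2 2 = 0"
    using E(1,2)[of 1 0 0 0 0] E(1,2)[of 0 1 0 0 0] E(1,2)[of 0 0 1 0 0] E(1,2)[of 0 0 0 1 0]
      E(1,2)[of 0 0 0 0 1] E(3)[of 1 0 0] E(3)[of 0 1 0] E(3)[of 0 0 1]
    by simp_all
qed

text \<open>A totally symmetric array is determined by its ten entries with sorted indices.\<close>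

lemma symmetric_eq_zero_if:
  fixes F :: "3 \<Rightarrow> 3 \<Rightarrow> 3 \<Rightarrow> real"
  assumes sym: "\<And>k j i. F k j i = F j k i" "\<And>k j i. F k j i = F k i j"
    and "F 1 1 1 = 0" "F 1 1 2 = 0" "F 1 1 3 = 0" "F 1 2 2 = 0" "F 1 2 3 = 0"
      "F 1 3 3 = 0" "F 2 2 2 = 0" "F 2 2 3 = 0" "F 2 3 3 = 0" "F 3 3 3 = 0"
  shows "F k j i = 0"
proof -
  have "\<forall>k j i. F k j i = 0"
    unfolding forall_3 by (intro conjI) (metis assms)+
  then show ?thesis by blast
qed

lemma universal_third_partials_zero:
  fixes u :: "real^3 \<Rightarrow> real^3" and x :: "real^3"
  assumes "open \<Omega>" "displacement_field \<Omega> u" "universal \<Omega> tetragonal_class_Z4 u" "x \<in> \<Omega>"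
  shows "partial k (partial j (partial i (\<lambda>y. u y $ l))) x = 0"
proof -
  define T where "T = (\<lambda>l k j i. partial k (partial j (partial i (\<lambda>y. u y $ l))) x)"
  have T: "T l k j i = T l j k i" "T l k j i = T l k i j" for l i j k
    unfolding T_def
    by (rule third_partial_commute[OF assms(1) smooth_component[OF assms(2)] assms(4)])+
  note U = universal_second_partials[OF assms(1-3)]
  note zero = partial_zero_on_open[OF assms(1,4)]
  have plane: "T l k 1 1 = 0" "T l k 2 2 = 0" "T l k 3 3 = 0" "T l k 1 2 = 0"
    if "l = 1 \<or> l = 2" for l k
    using that by (auto simp: T_def intro!: zero[OF U(1)] zero[OF U(2)] zero[OF U(3)]
        zero[OF U(4)] zero[OF U(5)] zero[OF U(6)] zero[OF U(7)] zero[OF U(8)])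
  have axial: "T 3 k 3 3 = 0" "T 3 k 1 3 = 0" "T 3 k 2 3 = 0" for k
    by (auto simp: T_def intro!: zero[OF U(10)] zero[OF U(11)] zero[OF U(12)])
  have harmonic: "T 3 k 1 1 + T 3 k 2 2 = 0" for k
  proof -
    have d: "partial a (partial b (\<lambda>y. u y $ 3)) differentiable at x" for a b
      using assms
      by (blast intro: smooth_field_differentiable smooth_field_partial smooth_component)
    have "partial k (\<lambda>x. partial 1 (partial 1 (\<lambda>y. u y $ 3)) x +
        partial 2 (partial 2 (\<lambda>y. u y $ 3)) x) x = 0"
      by (rule zero, rule U(13))
    then show ?thesis
      unfolding T_def by (simp add: partial_add d)
  qed
  have strain: "1/2 * (T l k j m + T m k j l) = partial k (partial j (strain u l m)) x" for k j l m
    unfolding T_def by (rule partial_partial_strain[OF assms(1,2,4), symmetric])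
  have "equilibrium \<Omega> (\<lambda>_ _ _ _. 0, coupling, \<lambda>_ _ _ _ _ _. 0) u"
    using assms(3) coupling_in_class unfolding universal_def by blast
  then have M: "(\<Sum>j\<in>UNIV. \<Sum>l\<in>UNIV. \<Sum>m\<in>UNIV. \<Sum>n\<in>UNIV.
      coupling i j l m n * (1/2 * (T l j n m + T m j n l))) -
    (\<Sum>j\<in>UNIV. \<Sum>k\<in>UNIV. \<Sum>l\<in>UNIV. \<Sum>m\<in>UNIV.
      coupling l m i j k * (1/2 * (T l k j m + T m k j l))) = 0" for i
    using assms(4) unfolding equilibrium_iff[OF assms(1,2)] strain by simp
  have halves: "(p + q) / 2 + (q + p) / 2 = p + q" for p q :: real
    by (simp add: field_simps)
  \<comment> \<open>For i = 1 the stress contributes u_1,113. The hyper-stress contributes u_1,113 +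
    u_3,111, one half from each of the entries 13111 and 31111. The case i = 2 is analogous.\<close>
  have "T 1 3 1 1 - (T 1 1 1 3 + T 3 1 1 1) = 0" "T 2 3 2 2 - (T 2 2 2 3 + T 3 2 2 2) = 0"
    using M[of 1] M[of 2] by (simp_all add: sum_3 coupling_def halves)
  moreover have "T 1 1 1 3 = T 1 3 1 1" "T 2 2 2 3 = T 2 3 2 2" by (metis T)+
  ultimately have cubic: "T 3 1 1 1 = 0" "T 3 2 2 2 = 0"
    using plane(1)[of 1 3] plane(2)[of 2 3] by simp_all
  \<comment> \<open>Any three indices either contain a repetition or contain both 1 and 2, so
    \<open>plane\<close> covers them all.\<close>
  have "T l k j i = 0" if "l = 1 \<or> l = 2"
    by (rule symmetric_eq_zero_if[of "T l", OF T]) (metis plane[OF that] T)+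
  moreover have "T 3 k j i = 0"
  proof -
    \<comment> \<open>Triples containing 3 fall under \<open>axial\<close>, and 111 and 222 are
      \<open>cubic\<close>. The differentiated harmonicity relation carries these over to 122 and
      112.\<close>
    have "T 3 1 2 2 = 0" "T 3 2 1 1 = 0"
      using harmonic[of 1] harmonic[of 2] cubic by simp_all
    then show ?thesis
      by - (rule symmetric_eq_zero_if[of "T 3", OF T]; metis axial cubic T)
  qed
  ultimately have "T l k j i = 0"
    using exhaust_3[of l] by blast
  then show ?thesis by (simp add: T_def)
qed

section \<open>Universality of the quadratic fields\<close>

lemma second_partials_quadratic_on:
  assumes "open \<Omega>" "x \<in> \<Omega>" "\<And>i j. h i j = h j i" "\<And>y. y \<in> \<Omega> \<Longrightarrow> f y = quadratic a b h y"
  shows "partial j (partial i f) x = h i j"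
proof -
  have "partial j (partial i f) x = partial j (partial i (quadratic a b h)) x"
    by (rule partial_cong_open[OF assms(1,2)], rule partial_cong_open[OF assms(1)])
       (use assms(4) in auto)
  then show ?thesis by (simp add: second_partial_quadratic assms(3))
qed

text \<open>First partials of the strain are constants built from the Hessians \<open>h l\<close>.
  \<open>M\<close> and \<open>A\<close> multiply only higher partials of the strain, so equilibrium
  reduces to the elastic part with its six constants.\<close>

lemma quadratic_universal:
  fixes u :: "real^3 \<Rightarrow> real^3"
  assumes "open \<Omega>" "displacement_field \<Omega> u"
    and u: "\<And>l x. x \<in> \<Omega> \<Longrightarrow> u x $ l = quadratic (a l) (b l) (h l) x"
    and sym: "\<And>l i j. h l i j = h l j i"
    and h: "h 1 1 1 = 0" "h 1 2 2 = 0" "h 1 3 3 = 0" "h 1 1 2 = 0"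
      "h 2 1 1 = 0" "h 2 2 2 = 0" "h 2 3 3 = 0" "h 2 1 2 = 0" "h 1 1 3 + h 2 2 3 = 0"
      "h 3 3 3 = 0" "h 3 1 3 = 0" "h 3 2 3 = 0" "h 3 1 1 + h 3 2 2 = 0"
  shows "universal \<Omega> tetragonal_class_Z4 u"
  unfolding universal_def
proof
  fix \<mu> assume mem: "\<mu> \<in> tetragonal_class_Z4"
  obtain C M A where \<mu>: "\<mu> = (C, M, A)" by (cases \<mu>)
  have "C = stiffness (C 1 1 1 1) (C 3 3 3 3) (C 1 1 2 2) (C 1 1 3 3) (C 1 3 1 3) (C 1 2 1 2)"
    using mem unfolding \<mu> tetragonal_class_Z4_def strain_gradient_material_def
    by (intro invariant_eq_stiffness) auto
  then obtain c11 c33 c12 c13 c44 c66 where C: "C = stiffness c11 c33 c12 c13 c44 c66" by blast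
  have U: "partial i (partial j (\<lambda>y. u y $ l)) x = h l i j" if "x \<in> \<Omega>" for x i j l
    using second_partials_quadratic_on[OF assms(1) that sym u] sym by metis
  have E1: "partial n (strain u l m) x = 1/2 * (h l n m + h m n l)" if "x \<in> \<Omega>" for x n l m
    using partial_strain[OF assms(1,2) that] U[OF that] by simp
  have E2: "partial j (partial n (strain u l m)) x = 0" if "x \<in> \<Omega>" for x j n l m
    by (rule partial_zero_on_open[OF assms(1) that E1])
  have E3: "partial k (partial j (partial n (strain u l m))) x = 0" if "x \<in> \<Omega>" for x k j n l m
    by (rule partial_zero_on_open[OF assms(1) that E2])
  have "(\<Sum>j\<in>UNIV. \<Sum>l\<in>UNIV. \<Sum>m\<in>UNIV. C i j l m * partial j (strain u l m) x) = 0"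
    if "x \<in> \<Omega>" for x i
  proof -
    note div = stiffness_divergence[OF assms(1,2) that]
    have "h 1 1 3 = - h 2 2 3" "h 3 1 1 = - h 3 2 2" using h by simp_all
    then have "\<forall>i. (\<Sum>j\<in>UNIV. \<Sum>l\<in>UNIV. \<Sum>m\<in>UNIV. C i j l m * partial j (strain u l m) x) = 0"
      unfolding forall_3 C div U[OF that] by (simp add: h)
    then show ?thesis by blast
  qed
  then show "equilibrium \<Omega> \<mu> u"
    unfolding \<mu> equilibrium_iff[OF assms(1,2)] by (simp add: E2 E3)
qed

theorem proposition3p19:
  fixes \<Omega> :: "(real^3) set" and u :: "real^3 \<Rightarrow> real^3"
  assumes "open \<Omega>" and "convex \<Omega>" and "\<Omega> \<noteq> {}"
    and "displacement_field \<Omega> u"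
  shows "universal \<Omega> tetragonal_class_Z4 u \<longleftrightarrow>
    (\<exists>(v :: real^3 \<Rightarrow> real^3) (w :: real^3 \<Rightarrow> real^3).
       homogeneous \<Omega> v \<and>
       (\<exists>c1 c2 c3 d1 d2 d3 d4 d5 :: real. \<forall>x\<in>\<Omega>. w x = vector
          [c1 * x $ 2 * x $ 3 + c2 * x $ 1 * x $ 3,
           - c2 * x $ 2 * x $ 3 + c3 * x $ 1 * x $ 3,
           d1 + d2 * x $ 1 + d3 * x $ 2 + d4 * x $ 1 * x $ 2
             + d5 * ((x $ 2)\<^sup>2 - (x $ 1)\<^sup>2)]) \<and>
       (\<forall>x\<in>\<Omega>. u x = v x + w x))"
    (is "_ \<longleftrightarrow> ?superposition")
proof
  assume univ: "universal \<Omega> tetragonal_class_Z4 u"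
  have "\<exists>a b h. (\<forall>i j. h i j = h j i) \<and> (\<forall>x\<in>\<Omega>. u x $ l = quadratic a b h x)" for l
    by (rule third_partials_zero_imp_quadratic[OF assms(1,2) smooth_component[OF assms(4)] assms(3)
          universal_third_partials_zero[OF assms(1,4) univ]]) blast+
  then obtain a b h where sym: "\<And>l i j. h l i j = h l j i"
    and u: "\<And>l x. x \<in> \<Omega> \<Longrightarrow> u x $ l = quadratic (a l) (b l) (h l) x"
    by metis
  obtain y where y: "y \<in> \<Omega>" using assms(3) by blast
  have U: "partial i (partial j (\<lambda>x. u x $ l)) y = h l i j" for i j l
    using second_partials_quadratic_on[OF assms(1) y sym u] sym by metis
  note h = universal_second_partials[OF assms(1,4) univ y, unfolded U]
  \<comment> \<open>The coefficients are entries of the Hessians. The affine terms of the third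
    component get coefficient 0, since \<open>v\<close> carries the whole affine part; the zeros are
    written out so that the required form is matched literally.\<close>
  define w :: "real^3 \<Rightarrow> real^3" where "w x = vector
    [h 1 2 3 * x $ 2 * x $ 3 + h 1 1 3 * x $ 1 * x $ 3,
     - h 1 1 3 * x $ 2 * x $ 3 + h 2 1 3 * x $ 1 * x $ 3,
     0 + 0 * x $ 1 + 0 * x $ 2 + h 3 1 2 * x $ 1 * x $ 2
       + h 3 2 2 / 2 * ((x $ 2)\<^sup>2 - (x $ 1)\<^sup>2)]" for x
  define v where "v x = (\<chi> l i. b l i) *v x + (\<chi> l. a l)" for x
  have "homogeneous \<Omega> v"
    unfolding homogeneous_def v_def by blast
  moreover have "u x = v x + w x" if "x \<in> \<Omega>" for x
  proof -
    have "h 2 2 3 = - h 1 1 3" "h 3 1 1 = - h 3 2 2" using h by simp_all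
    then show ?thesis
      using sym[of _ 2 1] sym[of _ 3 1] sym[of _ 3 2]
      by (simp add: vec_eq_iff forall_3 u[OF that] quadratic_def v_def w_def matrix_vector_mult_def
          sum_3 vector_3 h power2_eq_square algebra_simps)
  qed
  ultimately show ?superposition
    using w_def by blast
next
  assume ?superposition
  then obtain v w c1 c2 c3 d1 d2 d3 d4 d5 where "homogeneous \<Omega> v"
    and w: "\<And>x. x \<in> \<Omega> \<Longrightarrow> w x = vector
          [c1 * x $ 2 * x $ 3 + c2 * x $ 1 * x $ 3,
           - c2 * x $ 2 * x $ 3 + c3 * x $ 1 * x $ 3,
           d1 + d2 * x $ 1 + d3 * x $ 2 + d4 * x $ 1 * x $ 2
             + d5 * ((x $ 2)\<^sup>2 - (x $ 1)\<^sup>2)]"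
    and u: "\<And>x. x \<in> \<Omega> \<Longrightarrow> u x = v x + w x"
    by auto
  then obtain H b where v: "\<And>x. x \<in> \<Omega> \<Longrightarrow> v x = H *v x + b"
    unfolding homogeneous_def by blast
  \<comment> \<open>Under the factor 1/2 in \<open>quadratic\<close>, an off-diagonal entry
    \<open>c\<close> yields \<open>c\<close> times the product of the two coordinates, but a
    diagonal one only half of \<open>c\<close> times the square. This is why \<open>2 * d5\<close>
    appears in \<open>h\<close>.\<close>
  define entry :: "real \<Rightarrow> 3 \<Rightarrow> 3 \<Rightarrow> 3 \<Rightarrow> 3 \<Rightarrow> real" where
    "entry c p q i j = (if i = p \<and> j = q \<or> i = q \<and> j = p then c else 0)" for c p q i j
  define h where "h l i j =
    (if l = 1 then entry c1 2 3 i j + entry c2 1 3 i j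
     else if l = 2 then entry (- c2) 2 3 i j + entry c3 1 3 i j
     else entry d4 1 2 i j + entry (2 * d5) 2 2 i j + entry (- 2 * d5) 1 1 i j)" for l i j :: 3
  \<comment> \<open>The affine terms with \<open>d1\<close>, \<open>d2\<close>, \<open>d3\<close>
    are merged with those of the homogeneous field.\<close>
  define a where "a l = b $ l + (if l = 3 then d1 else 0)" for l
  define g where "g l i = H $ l $ i +
    (if l = 3 then if i = 1 then d2 else if i = 2 then d3 else 0 else 0)" for l i :: 3
  have "\<forall>l. u x $ l = quadratic (a l) (g l) (h l) x" if "x \<in> \<Omega>" for x
    unfolding forall_3
    by (simp add: u v w that quadratic_def a_def g_def h_def entry_def matrix_vector_mult_def
        sum_3 vector_3 power2_eq_square algebra_simps)
  moreover have "\<forall>l i j. h l i j = h l j i"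
    by (simp add: forall_3 h_def entry_def)
  ultimately show "universal \<Omega> tetragonal_class_Z4 u"
    by (intro quadratic_universal[OF assms(1,4), of a g h]) (blast | simp add: h_def entry_def)+
qed

end
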